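(* Let $H(1)\equiv H(t,1,s)=\sum_{n\ge0}t^n\sum_{(P,Q)\in\mathcal{I}_n}\sum_{i=0}^{2n}s^{Q(i)}$. Let $z=z(t)$ be the formal power series defined by $t=z(1-z)^3$, $z=t+O(t^2)$. Let $P(u,z,s)=s(1+u)^2z(uz^2+2z-1)+u(1-z)^3$ and let $U=U(z,s)\in\mathbb{Q}[s][[z]]$ be the unique formal power series with $P(U,z,s)=0$ (so $U=sz+O(z^2)$). Then $$H(1)=\frac{(1-2z-Uz^2)^2(1+U)}{(1-z)^6},$$ and equivalently the pair $(t,s)$ is parametrized rationally by $(z,U)$ via $t=z(1-z)^3$ and $s=\dfrac{U(1-z)^3}{z(1+U)^2(1-Uz^2-2z)}$.
   Context: A Dyck path of size $n$ is a lattice path from $(0,0)$ to $(2n,0)$ with $n$ up-steps $(1,1)$ and $n$ down-steps $(1,-1)$ never going below height $0$; $Q(i)$ denotes the height of $Q$ at abscissa $i$. The Tamari order on Dyck paths of size $n$ is the reflexive transitive closure of the relation: if $P$ has a down-step $d$ immediately followed by an up-step and $\mathfrak{e}$ is the shortest excursion following $d$ (a subpath staying strictly above its starting height except at its last point), the path obtained by exchanging $d$ and $\mathfrak{e}$ is larger than $P$. $\mathcal{I}_n$ is the set of pairs $(P,Q)$ of Dyck paths of size $n$ with $P\le Q$. *)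

theory Defs
  imports "HOL-Computational_Algebra.Polynomial" "HOL-Computational_Algebra.Formal_Power_Series"
begin

definition hgt :: "bool list \<Rightarrow> int" where
  "hgt w = (\<Sum>b\<leftarrow>w. if b then 1 else -1)"

definition height_at :: "bool list \<Rightarrow> nat \<Rightarrow> nat" where
  "height_at Q i = nat (hgt (take i Q))"

definition dyck :: "nat \<Rightarrow> bool list \<Rightarrow> bool" where
  "dyck n w \<longleftrightarrow> length w = 2 * n \<and> hgt w = 0 \<and> (\<forall>i\<le>length w. hgt (take i w) \<ge> 0)"

text \<open>An excursion: a nonempty subpath ending at its starting height and staying strictly
  above it at all intermediate points (hence it is the shortest excursion from its start).\<close>
definition excursion :: "bool list \<Rightarrow> bool" where
  "excursion e \<longleftrightarrow> e \<noteq> [] \<and> hgt e = 0 \<and> (\<forall>i. 0 < i \<and> i < length e \<longrightarrow> hgt (take i e) > 0)"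

definition tamari_step :: "bool list \<Rightarrow> bool list \<Rightarrow> bool" where
  "tamari_step P Q \<longleftrightarrow> (\<exists>A e B. excursion e \<and> P = A @ [False] @ e @ B \<and> Q = A @ e @ [False] @ B)"

definition tamari_le :: "bool list \<Rightarrow> bool list \<Rightarrow> bool" where
  "tamari_le P Q = tamari_step\<^sup>*\<^sup>* P Q"

definition intervals :: "nat \<Rightarrow> (bool list \<times> bool list) set" where
  "intervals n = {(P, Q). dyck n P \<and> dyck n Q \<and> tamari_le P Q}"

definition H1 :: "rat poly fps" where
  "H1 = Abs_fps (\<lambda>n. \<Sum>(P, Q)\<in>intervals n. \<Sum>i = 0..2 * n. monom 1 (height_at Q i))"

end

theory Submission
  imports Defs
begin

text \<open>
  An interval \<open>(P, Q)\<close> with \<open>Q = u Q1 d Q2\<close> arises uniquely from intervals \<open>(P1, Q1)\<close> and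
  \<open>(P2, Q2)\<close> and a factorisation \<open>P1 = l r\<close> into Dyck paths, as \<open>P = u l d r P2\<close>. With \<open>x\<close> marking the
  returns of \<open>P\<close> to the axis, this gives a quadratic equation for the series \<open>E(x)\<close> of intervals and a
  linear one for the series \<open>H(x)\<close> of intervals with a marked abscissa:
  \<open>(x - 1) (E(x) - 1) = t x (x E(x) - E(1)) E(x)\<close> and
  \<open>(x - 1) (H(x) - 1) = t x ((x E(x) - E(1)) E(x) + s (x H(x) - H(1)) E(x) + (x E(x) - E(1)) H(x))\<close>.
  At \<open>x = (1 + U) / (1 + z U)\<^sup>2\<close> the quadratic equation, together with the fact that \<open>E(1)\<close> does not
  involve \<open>s\<close>, determines both \<open>E(x)\<close> and \<open>E(1)\<close>. At this value the coefficient of \<open>H(x)\<close> in the linear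
  equation vanishes, which leaves \<open>H(1) = x E(x)\<^sup>2\<close>.
\<close>

section \<open>Decomposition of Tamari intervals\<close>

lemma hgt_simps [simp]:
  "hgt [] = 0" "hgt (b # w) = (if b then 1 else -1) + hgt w" "hgt (v @ w) = hgt v + hgt w"
  by (auto simp: hgt_def)

text \<open>Prefixes are given by factorisations instead of indices, so that case splits on
  equations between concatenations apply directly.\<close>

definition dyck_word :: "bool list \<Rightarrow> bool" where
  "dyck_word w \<longleftrightarrow> hgt w = 0 \<and> (\<forall>u v. w = u @ v \<longrightarrow> hgt u \<ge> 0)"

lemma dyck_wordI:
  assumes "hgt w = 0" "\<And>u v. w = u @ v \<Longrightarrow> hgt u \<ge> 0"
  shows "dyck_word w"
  using assms by (auto simp: dyck_word_def)

lemma dyck_word_hgt: "dyck_word w \<Longrightarrow> hgt w = 0"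
  by (simp add: dyck_word_def)

lemma dyck_word_prefix: "dyck_word (u @ v) \<Longrightarrow> hgt u \<ge> 0"
  by (auto simp: dyck_word_def)

lemma dyck_iff: "dyck n w \<longleftrightarrow> length w = 2 * n \<and> dyck_word w"
proof -
  have "(\<forall>i\<le>length w. hgt (take i w) \<ge> 0) \<longleftrightarrow> (\<forall>u v. w = u @ v \<longrightarrow> hgt u \<ge> 0)"
    by (metis append_eq_conv_conj append_take_drop_id length_append le_add1)
  then show ?thesis
    unfolding dyck_def dyck_word_def by blast
qed

lemma even_length_dyck_word: "dyck_word w \<Longrightarrow> even (length w)"
proof -
  \<comment> \<open>Each letter changes the length by 1 and the height by 1 or -1.\<close>
  have "even (int (length w) + hgt w)" for w
    by (induction w) auto
  then show "dyck_word w \<Longrightarrow> even (length w)"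
    by (metis add.right_neutral dyck_word_hgt even_of_nat)
qed

lemma dyck_word_Nil [simp]: "dyck_word []"
  by (simp add: dyck_word_def)

lemma dyck_word_append:
  assumes "dyck_word u" "dyck_word v"
  shows "dyck_word (u @ v)"
proof (rule dyck_wordI)
  fix a b assume "u @ v = a @ b"
  then show "hgt a \<ge> 0"
    using assms by (auto simp: append_eq_append_conv2 dyck_word_def)
qed (use assms in \<open>simp add: dyck_word_hgt\<close>)

lemma dyck_word_append_cancel:
  assumes "dyck_word u" "dyck_word (u @ v)"
  shows "dyck_word v"
proof (rule dyck_wordI)
  show "hgt v = 0"
    using assms[THEN dyck_word_hgt] by simp
next
  fix a b assume "v = a @ b"
  then show "hgt a \<ge> 0"
    using dyck_word_prefix[of "u @ a" b] assms dyck_word_hgt[of u] by simp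
qed

lemma dyck_word_arch:
  assumes "dyck_word l"
  shows "dyck_word (True # l @ [False])"
proof (rule dyck_wordI)
  fix a b assume "True # l @ [False] = a @ b"
  then consider "a = []" | a' where "a = True # a'" "l @ [False] = a' @ b"
    by (auto simp: Cons_eq_append_conv)
  then show "hgt a \<ge> 0"
  proof cases
    case 2
    then show ?thesis
      using assms by (auto simp: append_eq_append_conv2 Cons_eq_append_conv dyck_word_def)
  qed simp
qed (use assms in \<open>simp add: dyck_word_hgt\<close>)

lemma dyck_word_node:
  assumes "dyck_word l" "dyck_word r"
  shows "dyck_word (True # l @ False # r)"
  using dyck_word_append[OF dyck_word_arch] assms by simp

lemma excursion_arch:
  assumes "dyck_word l"
  shows "excursion (True # l @ [False])"
  unfolding excursion_def
proof (intro conjI allI impI)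
  fix i assume i: "0 < i \<and> i < length (True # l @ [False])"
  then obtain j where j: "i = Suc j" "j \<le> length l"
    by (cases i) auto
  then show "hgt (take i (True # l @ [False])) > 0"
    using dyck_word_prefix[of "take j l" "drop j l"] assms by simp
qed (use assms in \<open>auto simp: dyck_word_hgt\<close>)

lemma excursion_prefix:
  assumes "excursion (u @ v)" "u \<noteq> []" "v \<noteq> []"
  shows "hgt u > 0"
proof -
  have "hgt (take (length u) (u @ v)) > 0"
    using assms unfolding excursion_def by (metis add_less_same_cancel1 append_take_drop_id
      length_append length_greater_0_conv less_add_same_cancel1)
  then show ?thesis by simp
qed

text \<open>The cut is at the first return to the axis, \<open>k\<close>. All heights strictly
  between 0 and \<open>k\<close> are positive, so the enclosed word \<open>l\<close> never goes
  below height 1.\<close>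

lemma dyck_word_cases [consumes 1, case_names Nil node]:
  assumes "dyck_word w"
  obtains "w = []" | l r where "w = True # l @ False # r" "dyck_word l" "dyck_word r"
proof (cases "w = []")
  case False
  define k where "k = (LEAST i. 0 < i \<and> hgt (take i w) = 0)"
  have ex: "0 < length w \<and> hgt (take (length w) w) = 0"
    using False assms by (simp add: dyck_word_hgt)
  have k: "0 < k" "hgt (take k w) = 0"
    using LeastI[of "\<lambda>i. 0 < i \<and> hgt (take i w) = 0", OF ex] unfolding k_def by auto
  have kle: "k \<le> length w"
    unfolding k_def by (rule Least_le) (rule ex)
  have pos: "hgt (take i w) > 0" if "0 < i" "i < k" for i
  proof -
    have "hgt (take i w) \<noteq> 0"
      using not_less_Least[of i "\<lambda>i. 0 < i \<and> hgt (take i w) = 0"] that unfolding k_def by blast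
    moreover have "hgt (take i w) \<ge> 0"
      using dyck_word_prefix[of "take i w" "drop i w"] assms by simp
    ultimately show ?thesis by simp
  qed
  have upos: "hgt u > 0" if "take k w = u @ v" "u \<noteq> []" "v \<noteq> []" for u v
  proof -
    have len: "length u + length v = k"
      using that(1) kle by (metis length_append length_take min.absorb2)
    have "u = take (length u) (take k w)"
      using that(1) by simp
    then have "u = take (length u) w"
      using len by (simp add: min_def)
    then show ?thesis
      using pos[of "length u"] that len by (cases v) auto
  qed
  obtain b e where be: "take k w = b # e"
    using k False by (cases "take k w") auto
  have e0: "e \<noteq> []"
    using be k by (auto split: if_splits)
  then obtain l c where e: "e = l @ [c]"
    by (metis rev_exhaust)
  \<comment> \<open>The height is positive after the first letter and before the last one, and 0 at
    both ends.\<close>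
  have b: "b"
    using upos[of "[b]" e] be e0 by (auto split: if_splits)
  have c: "\<not> c"
    using upos[of "b # l" "[c]"] be e k by (auto split: if_splits)
  have w: "w = True # l @ False # drop k w"
    using append_take_drop_id[of k w] be e b c by simp
  have l: "dyck_word l"
  proof (rule dyck_wordI)
    show "hgt l = 0"
      using k be e b c by simp
    fix u v assume "l = u @ v"
    then show "hgt u \<ge> 0"
      using upos[of "True # u" "v @ [c]"] be e b by simp
  qed
  then have "dyck_word (drop k w)"
    using dyck_word_append_cancel[OF dyck_word_arch[OF l], of "drop k w"] assms w by simp
  then show ?thesis
    using that(2)[OF w l] by blast
qed (use that in blast)

lemma dyck_word_induct [consumes 1, case_names Nil node]:
  assumes "dyck_word w" "P []"
    and "\<And>l r. dyck_word l \<Longrightarrow> dyck_word r \<Longrightarrow> P l \<Longrightarrow> P r \<Longrightarrow> P (True # l @ False # r)"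
  shows "P w"
  using assms(1)
proof (induction w rule: length_induct)
  case (1 w)
  from \<open>dyck_word w\<close> show ?case
  proof (cases rule: dyck_word_cases)
    case (node l r)
    then show ?thesis
      using 1(1) by (auto intro!: assms(3))
  qed (simp add: assms(2))
qed

text \<open>If \<open>l\<close> and \<open>l'\<close> differed, the shorter one followed by its
  down-step would be a prefix of the longer one, with height -1.\<close>

lemma dyck_node_inject:
  assumes "True # l @ False # r = True # l' @ False # r'" "dyck_word l" "dyck_word l'"
  shows "l = l' \<and> r = r'"
  using assms dyck_word_prefix[of "l @ [False]"] dyck_word_prefix[of "l' @ [False]"]
  by (auto simp: append_eq_append_conv2 Cons_eq_append_conv append_eq_Cons_conv dyck_word_hgt)

section \<open>The Tamari order and the first-return decomposition\<close>

lemma tamari_step_context: "tamari_step P Q \<Longrightarrow> tamari_step (A @ P @ B) (A @ Q @ B)"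
  unfolding tamari_step_def by (metis append.assoc)

lemma tamari_le_refl [simp]: "tamari_le P P"
  by (simp add: tamari_le_def)

lemma tamari_le_trans [trans]: "tamari_le P Q \<Longrightarrow> tamari_le Q R \<Longrightarrow> tamari_le P R"
  by (simp add: tamari_le_def)

lemma tamari_step_le_trans: "tamari_step P Q \<Longrightarrow> tamari_le Q R \<Longrightarrow> tamari_le P R"
  by (simp add: tamari_le_def)

lemma tamari_le_context:
  assumes "tamari_le P Q"
  shows "tamari_le (A @ P @ B) (A @ Q @ B)"
  using assms unfolding tamari_le_def
  by (induction) (auto intro: rtranclp.rtrancl_into_rtrancl tamari_step_context)

lemma length_tamari_step: "tamari_step P Q \<Longrightarrow> length P = length Q"
  by (auto simp: tamari_step_def)

lemma length_tamari_le: "tamari_le P Q \<Longrightarrow> length P = length Q"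
  unfolding tamari_le_def by (induction rule: rtranclp_induct) (auto simp: length_tamari_step)

text \<open>The down-step jumps over the arches of \<open>r\<close> one at a time, each arch being
  an excursion.\<close>

lemma tamari_le_swap:
  assumes "dyck_word r"
  shows "tamari_le (False # r) (r @ [False])"
  using assms
proof (induction rule: dyck_word_induct)
  case (node l r)
  let ?e = "True # l @ [False]"
  have "tamari_step (False # ?e @ r) (?e @ False # r)"
    unfolding tamari_step_def using excursion_arch[OF node(1)]
    by (metis append.left_neutral append_Cons)
  moreover have "tamari_le (?e @ False # r) (?e @ r @ [False])"
    using tamari_le_context[OF node(4), of ?e "[]"] by simp
  ultimately show ?case
    using tamari_step_le_trans by fastforce
qed simp

text \<open>The down-step closing the first arch moves past \<open>r\<close>; then the given chains
  are applied inside the arch and after it.\<close>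

lemma tamari_le_node:
  assumes "dyck_word r" "tamari_le (l @ r) Q1" "tamari_le P2 Q2"
  shows "tamari_le (True # l @ False # r @ P2) (True # Q1 @ False # Q2)"
proof -
  have "tamari_le (True # l @ False # r @ P2) (True # l @ r @ False # P2)"
    using tamari_le_context[OF tamari_le_swap[OF assms(1)], of "True # l" P2] by simp
  also have "tamari_le \<dots> (True # Q1 @ False # P2)"
    using tamari_le_context[OF assms(2), of "[True]" "False # P2"] by simp
  also have "tamari_le \<dots> (True # Q1 @ False # Q2)"
    using tamari_le_context[OF assms(3), of "True # Q1 @ [False]" "[]"] by simp
  finally show ?thesis .
qed

text \<open>Undoing an exchange lowers \<open>e\<close> by one. This is harmless because
  \<open>A\<close> ends at height at least 1: in the larger word a down-step leaves from that same
  height after \<open>e\<close>.\<close>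

lemma dyck_word_unswap:
  assumes "excursion e" "dyck_word (A @ e @ [False] @ B)"
  shows "dyck_word (A @ [False] @ e @ B)"
proof (rule dyck_wordI)
  have e: "hgt e = 0"
    using assms by (simp add: excursion_def)
  show "hgt (A @ [False] @ e @ B) = 0"
    using dyck_word_hgt[OF assms(2)] by simp
  have A: "hgt A \<ge> 1"
    using dyck_word_prefix[of "A @ e @ [False]" B] assms(2) e by simp
  have pe: "hgt x \<ge> 0" if "e = x @ y" for x y
    using excursion_prefix[of x y] that assms(1) e by (cases "x = [] \<or> y = []") auto
  fix u v assume "A @ [False] @ e @ B = u @ v"
  then consider y where "A = u @ y" | x y where "u = A @ False # x" "e = x @ y" |
     x where "u = A @ False # e @ x" "B = x @ v"
    by (auto simp: append_eq_append_conv2 Cons_eq_append_conv append_eq_Cons_conv)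
  then show "hgt u \<ge> 0"
  proof cases
    case 1
    then show ?thesis
      using dyck_word_prefix[of u "y @ e @ [False] @ B"] assms(2) by simp
  next
    case 2
    then show ?thesis
      using pe[OF 2(2)] A by simp
  next
    case 3
    then show ?thesis
      using dyck_word_prefix[of "A @ e @ [False] @ x" v] assms(2) by simp
  qed
qed

text \<open>\<open>w\<close> ends at height 0, whereas \<open>e\<close> stays at or above the
  positive height of \<open>A\<close>. So \<open>w\<close> extends past \<open>e\<close> and over
  the down-step behind it.\<close>

lemma excursion_within_dyck_word:
  assumes "w @ v = A @ e @ [False] @ B" "excursion e" "hgt w = 0" "hgt A > 0" "length A < length w"
  obtains B' where "w = A @ e @ [False] @ B'" "B = B' @ v"
proof -
  obtain C where "w = A @ C"
    using assms(1,5) by (auto simp: append_eq_append_conv2)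
  then have C: "w = A @ C" "C @ v = e @ [False] @ B"
    using assms(1) by simp_all
  have "hgt C < 0"
    using C(1) assms(3,4) by simp
  have "hgt x \<ge> 0" if "e = x @ y" for x y
    using excursion_prefix[of x y] that assms(2)
    by (cases "x = [] \<or> y = []") (auto simp: excursion_def)
  with \<open>hgt C < 0\<close> have "\<not> (\<exists>y. e = C @ y)"
    by fastforce
  then obtain D where "C = e @ D" "D @ v = False # B" "D \<noteq> []"
    using C(2) by (auto simp: append_eq_append_conv2)
  then obtain B' where "C = e @ False # B'" "B = B' @ v"
    by (auto simp: append_eq_Cons_conv)
  then show ?thesis
    using that C(1) by simp
qed

text \<open>Induction backwards along the chain. Undoing an exchange inside \<open>l\<close>,
  \<open>r\<close> or \<open>P2\<close> keeps the shape. The one other possibility concerns the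
  down-step closing the first arch: the last arch of \<open>l\<close> then moves to the front of
  \<open>r\<close>, and \<open>l @ r\<close> is unchanged.\<close>

lemma tamari_le_node_decomp:
  assumes "tamari_le P (True # Q1 @ False # Q2)" "dyck_word Q1" "dyck_word Q2"
  shows "\<exists>l r P2. P = True # l @ False # r @ P2 \<and> dyck_word l \<and> dyck_word r \<and> dyck_word P2 \<and>
           tamari_le (l @ r) Q1 \<and> tamari_le P2 Q2"
  using assms(1)[unfolded tamari_le_def]
proof (induction rule: converse_rtranclp_induct)
  case base
  show ?case
    using assms by (metis append_Nil append_Nil2 dyck_word_Nil tamari_le_refl)
next
  case (step P P')
  then obtain l r P2 where P': "P' = True # l @ False # r @ P2"
    and d: "dyck_word l" "dyck_word r" "dyck_word P2"
    and le: "tamari_le (l @ r) Q1" "tamari_le P2 Q2"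
    by blast
  from step(1) obtain A e B where e: "excursion e" and P: "P = A @ [False] @ e @ B"
    and P'e: "P' = A @ e @ [False] @ B"
    by (auto simp: tamari_step_def)
  have e0: "hgt e = 0" "e \<noteq> []"
    using e by (auto simp: excursion_def)
  have dP': "dyck_word P'"
    unfolding P' using d by (intro dyck_word_node dyck_word_append)
  have A: "hgt A \<ge> 1"
    using dyck_word_prefix[of "A @ e @ [False]" B] dP' P'e e0 by simp
  have hd_e: "\<exists>e'. e = True # e'"
    using e0 excursion_prefix[of "[hd e]" "tl e"] e
    by (cases e; cases "tl e") (auto split: if_splits)
  have witness: "\<exists>l r P2. P = True # l @ False # r @ P2 \<and> dyck_word l \<and> dyck_word r \<and> dyck_word P2 \<and>
           tamari_le (l @ r) Q1 \<and> tamari_le P2 Q2"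
    if "P = True # l @ False # r @ P2" "dyck_word l" "dyck_word r" "dyck_word P2"
      "tamari_le (l @ r) Q1" "tamari_le P2 Q2" for l r P2
    using that by blast
  obtain A' where A': "A = True # A'"
    using A P' P'e by (cases A) auto
  have eq: "l @ False # r @ P2 = A' @ e @ [False] @ B"
    using P' P'e A' by simp
  have step_ctx: "tamari_step (x @ [False] @ e @ y) (x @ e @ [False] @ y)" for x y
    using e by (auto simp: tamari_step_def)
  consider "length A' < length l" | "length A' = length l" | "length A' > length l"
    by linarith
  then show ?case
  proof cases
    case 1
    show ?thesis
    proof (cases "hgt A' = 0")
      case False
      then have "hgt A' > 0"
        using A A' by simp
      then obtain B' where B': "l = A' @ e @ [False] @ B'" "B = B' @ False # r @ P2"
        using excursion_within_dyck_word[OF eq e _ _ 1] d(1) dyck_word_hgt by blast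
      let ?l = "A' @ [False] @ e @ B'"
      have "tamari_le (?l @ r) Q1"
        using tamari_step_le_trans[OF step_ctx[of A' "B' @ r"]] le(1) B' by simp
      moreover have "dyck_word ?l"
        using dyck_word_unswap[OF e] d(1) B' by simp
      ultimately show ?thesis
        using d le P A' B' by (intro witness[of ?l r P2]) simp_all
    next
      \<comment> \<open>The exchanged down-step is the one that closes the first arch of
        \<open>P\<close>.\<close>
      case True
      obtain C where "l = A' @ C"
        using 1 eq by (auto simp: append_eq_append_conv2)
      then have C: "l = A' @ C" "C \<noteq> []" "C @ False # r @ P2 = e @ [False] @ B"
        using 1 eq by auto
      have hC: "hgt C = 0"
        using d(1) C(1) True dyck_word_hgt by fastforce
      \<comment> \<open>A nonempty proper prefix of \<open>e\<close> has positive height, and a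
        longer \<open>C\<close> would take \<open>l\<close> down to height -1.\<close>
      have "C = e"
      proof -
        consider y where "y \<noteq> []" "e = C @ y" | "C = e" | y where "C = e @ False # y"
          using C(3) by (auto simp: append_eq_append_conv2 append_eq_Cons_conv)
        then show ?thesis
        proof cases
          case 1
          then show ?thesis
            using excursion_prefix[of C y] e C(2) hC by simp
        next
          case 3
          then show ?thesis
            using dyck_word_prefix[of "A' @ e @ [False]" y] C(1) d(1) True e0 by simp
        qed
      qed
      then have *: "P = True # A' @ False # (e @ r) @ P2" "l = A' @ e"
        using P A' C by simp_all
      have "dyck_word e"
        by (rule dyck_wordI) (use excursion_prefix e e0 in \<open>force+\<close>)
      moreover have "dyck_word A'"
      proof (rule dyck_wordI[OF True])
        fix x y assume "A' = x @ y"
        then show "hgt x \<ge> 0"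
          using dyck_word_prefix[of x "y @ e"] d(1) * by simp
      qed
      ultimately show ?thesis
        using * d le by (intro witness[of A' "e @ r" P2]) (auto intro: dyck_word_append)
    qed
  next
    \<comment> \<open>A down-step follows \<open>l\<close>, but \<open>e\<close> begins with an
      up-step.\<close>
    case 2
    then show ?thesis
      using eq hd_e by auto
  next
    case 3
    then obtain A'' where A'': "A' = l @ False # A''" "r @ P2 = A'' @ e @ [False] @ B"
      using eq by (auto simp: append_eq_append_conv2 Cons_eq_append_conv)
    have hA'': "hgt A'' > 0"
      using A A' A''(1) d(1) dyck_word_hgt by fastforce
    show ?thesis
    proof (cases "length A'' < length r")
      case True
      then obtain B' where B': "r = A'' @ e @ [False] @ B'" "B = B' @ P2"
        using excursion_within_dyck_word[OF A''(2) e _ hA''] d(2) dyck_word_hgt by blast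
      let ?r = "A'' @ [False] @ e @ B'"
      have "tamari_le (l @ ?r) Q1"
        using tamari_step_le_trans[OF step_ctx[of "l @ A''" "B'"]] le(1) B' by simp
      moreover have "dyck_word ?r"
        using dyck_word_unswap[OF e] d(2) B' by simp
      ultimately show ?thesis
        using d le P A' A'' B' by (intro witness[of l ?r P2]) simp_all
    next
      case False
      then obtain C where C: "A'' = r @ C" "P2 = C @ e @ [False] @ B"
        using A''(2) by (auto simp: append_eq_append_conv2)
      let ?P2 = "C @ [False] @ e @ B"
      have "tamari_le ?P2 Q2"
        using tamari_step_le_trans[OF step_ctx[of C B]] le(2) C by simp
      moreover have "dyck_word ?P2"
        using dyck_word_unswap[OF e] d(3) C by simp
      ultimately show ?thesis
        using d le P A' A'' C by (intro witness[of l r ?P2]) simp_all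
    qed
  qed
qed

text \<open>The number of returns to height 0 of a path starting at height \<open>h\<close>; the starting point is
  not counted, so \<open>returns 0\<close> is the number of contacts minus one.\<close>
fun returns :: "int \<Rightarrow> bool list \<Rightarrow> nat" where
  "returns h [] = 0"
| "returns h (b # w) = (let h' = h + (if b then 1 else -1) in of_bool (h' = 0) + returns h' w)"

lemma returns_append: "returns h (v @ w) = returns h v + returns (h + hgt v) w"
  by (induction v arbitrary: h) (auto simp: Let_def add.assoc)

lemma returns_eq_0:
  assumes "\<And>u v. w = u @ v \<Longrightarrow> h + hgt u > 0"
  shows "returns h w = 0"
  using assms
proof (induction w arbitrary: h)
  case (Cons b w)
  let ?h = "h + (if b then 1 else -1)"
  have *: "?h + hgt u > 0" if "w = u @ v" for u v
    using Cons.prems[of "b # u" v] that by (auto split: if_splits)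
  show ?case
    using Cons.IH[OF *] *[of "[]" w] by (auto simp: Let_def)
qed simp

lemma returns_node:
  assumes "dyck_word l"
  shows "returns 0 (True # l @ False # r) = Suc (returns 0 r)"
proof -
  have "returns 1 l = 0"
    using dyck_word_prefix assms by (intro returns_eq_0) fastforce
  then show ?thesis
    using assms by (simp add: returns_append dyck_word_hgt Let_def)
qed

lemma returns_dyck_append:
  "dyck_word u \<Longrightarrow> returns 0 (u @ v) = returns 0 u + returns 0 v"
  by (simp add: returns_append dyck_word_hgt)

text \<open>For \<open>f h = s ^ nat h\<close> this is the weight of a marked abscissa. A general
  \<open>f\<close> absorbs the height shifts when letters are removed.\<close>

definition hsum :: "(int \<Rightarrow> 'a::comm_monoid_add) \<Rightarrow> bool list \<Rightarrow> 'a" where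
  "hsum f w = (\<Sum>i\<le>length w. f (hgt (take i w)))"

lemma hsum_Nil [simp]: "hsum f [] = f 0"
  by (simp add: hsum_def)

lemma hsum_Cons: "hsum f (b # w) = f 0 + hsum (\<lambda>h. f ((if b then 1 else -1) + h)) w"
  unfolding hsum_def list.size(4) add_Suc_right add_0_right sum.atMost_Suc_shift by simp

lemmas [simp del] = returns.simps(2)

lemma hsum_append_Cons:
  "hsum f (v @ b # w) = hsum f v + hsum (\<lambda>h. f (hgt v + (if b then 1 else -1) + h)) w"
  by (induction v arbitrary: f) (auto simp: hsum_Cons add.assoc)

text \<open>The three terms come from the origin, from \<open>l\<close> raised by one, and from the
  end of the first arch onwards.\<close>

lemma hsum_power_node:
  fixes s :: "'a::comm_semiring_1"
  assumes "dyck_word l"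
  shows "hsum (\<lambda>h. s ^ nat h) (True # l @ False # r) =
    1 + s * hsum (\<lambda>h. s ^ nat h) l + hsum (\<lambda>h. s ^ nat h) r"
proof -
  have "s ^ nat (1 + hgt (take i l)) = s * s ^ nat (hgt (take i l))" for i
    using dyck_word_prefix[of "take i l" "drop i l"] assms by (simp add: nat_add_distrib)
  then have "hsum (\<lambda>h. s ^ nat (1 + h)) l = s * hsum (\<lambda>h. s ^ nat h) l"
    by (simp add: hsum_def sum_distrib_left)
  then show ?thesis
    using assms by (simp add: hsum_Cons hsum_append_Cons dyck_word_hgt add.assoc)
qed

section \<open>Cutting a Dyck word at its contacts with the axis\<close>

definition splits :: "bool list \<Rightarrow> (bool list \<times> bool list) set" where
  "splits w = {(l, r). l @ r = w \<and> dyck_word l \<and> dyck_word r}"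

lemma finite_splits [simp]: "finite (splits w)"
proof (rule finite_subset)
  show "splits w \<subseteq> (\<lambda>i. (take i w, drop i w)) ` {..length w}"
  proof
    fix p assume "p \<in> splits w"
    then have "p = (take (length (fst p)) w, drop (length (fst p)) w) \<and> length (fst p) \<le> length w"
      by (auto simp: splits_def)
    then show "p \<in> (\<lambda>i. (take i w, drop i w)) ` {..length w}"
      by blast
  qed
qed simp

lemma splits_node:
  assumes "dyck_word l" "dyck_word r"
  shows "splits (True # l @ False # r) =
    insert ([], True # l @ False # r) ((\<lambda>(a, b). (True # l @ False # a, b)) ` splits r)"
proof (intro equalityI subsetI)
  fix p assume "p \<in> splits (True # l @ False # r)"
  then obtain a b where p: "p = (a, b)" "a @ b = True # l @ False # r" "dyck_word a" "dyck_word b"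
    by (auto simp: splits_def)
  from p(3) show "p \<in> insert ([], True # l @ False # r) ((\<lambda>(a, b). (True # l @ False # a, b)) ` splits r)"
  proof (cases rule: dyck_word_cases)
    case (node l' r')
    then have "l' = l \<and> r' @ b = r"
      using dyck_node_inject[of l' "r' @ b" l r] p assms by simp
    then have "p = (\<lambda>(a, b). (True # l @ False # a, b)) (r', b)" "(r', b) \<in> splits r"
      using p node by (auto simp: splits_def)
    then show ?thesis by blast
  qed (use p in simp)
next
  fix p assume "p \<in> insert ([], True # l @ False # r) ((\<lambda>(a, b). (True # l @ False # a, b)) ` splits r)"
  then show "p \<in> splits (True # l @ False # r)"
    using assms by (auto simp: splits_def dyck_word_node)
qed

text \<open>The right parts have 0, 1, ..., \<open>returns 0 w\<close> returns, each value once, so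
  the sum is geometric.\<close>

lemma sum_splits_power:
  fixes x :: "'a::comm_ring_1"
  assumes "dyck_word w"
  shows "(x - 1) * (\<Sum>(l, r)\<in>splits w. x ^ returns 0 r) = x * x ^ returns 0 w - 1"
  using assms
proof (induction rule: dyck_word_induct)
  case Nil
  have "splits [] = {([], [])}"
    by (auto simp: splits_def)
  then show ?case by simp
next
  case (node l r)
  let ?w = "True # l @ False # r"
  have "inj_on (\<lambda>(a, b). (True # l @ False # a, b)) (splits r)"
    by (auto simp: inj_on_def)
  then have "(\<Sum>(l, r)\<in>splits ?w. x ^ returns 0 r) = x ^ returns 0 ?w + (\<Sum>(l, r)\<in>splits r. x ^ returns 0 r)"
    unfolding splits_node[OF node(1,2)]
    by (subst sum.insert) (auto simp: sum.reindex split_def intro!: finite_imageI)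
  then show ?case
    using node by (simp add: distrib_left returns_node) (simp add: algebra_simps)
qed

section \<open>Bijective decomposition of nonempty intervals\<close>

lemma intervalsD:
  assumes "(P, Q) \<in> intervals n"
  shows "dyck_word P" "dyck_word Q" "length P = 2 * n" "length Q = 2 * n" "tamari_le P Q"
  using assms by (auto simp: intervals_def dyck_iff)

lemma intervalsI:
  assumes "dyck_word P" "dyck_word Q" "length Q = 2 * n" "tamari_le P Q"
  shows "(P, Q) \<in> intervals n"
  using assms length_tamari_le[OF assms(4)] by (auto simp: intervals_def dyck_iff)

lemma finite_intervals [simp]: "finite (intervals n)"
proof (rule finite_subset)
  show "intervals n \<subseteq> {w. set w \<subseteq> UNIV \<and> length w = 2 * n} \<times> {w. set w \<subseteq> UNIV \<and> length w = 2 * n}"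
    by (auto dest: intervalsD)
qed (intro finite_cartesian_product finite_lists_length_eq finite)

lemma intervals_0: "intervals 0 = {([], [])}"
  by (auto simp: intervals_def dyck_iff)

text \<open>\<open>Q\<close> determines \<open>Q1\<close>, \<open>Q2\<close> and thus
  \<open>m\<close>; the length of \<open>P2\<close> is then known, which separates \<open>r\<close>
  from \<open>P2\<close>. Surjectivity is \<open>tamari_le_node_decomp\<close>.\<close>

lemma bij_betw_intervals_Suc:
  "bij_betw (\<lambda>(m, (P1, Q1), (P2, Q2), (l, r)). (True # l @ False # r @ P2, True # Q1 @ False # Q2))
     (SIGMA m:{..n}. SIGMA I1:intervals m. SIGMA I2:intervals (n - m). splits (fst I1))
     (intervals (Suc n))" (is "bij_betw ?f ?Z _")
  unfolding bij_betw_def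
proof (intro conjI equalityI subsetI)
  show "inj_on ?f ?Z"
  proof (rule inj_onI, clarsimp)
    fix m P1 Q1 P2 Q2 l r m' P1' Q1' P2' Q2' l' r'
    assume I: "(P1, Q1) \<in> intervals m" "(P2, Q2) \<in> intervals (n - m)" "(l, r) \<in> splits P1"
      and I': "(P1', Q1') \<in> intervals m'" "(P2', Q2') \<in> intervals (n - m')" "(l', r') \<in> splits P1'"
      and eqP: "l @ False # r @ P2 = l' @ False # r' @ P2'"
      and eqQ: "Q1 @ False # Q2 = Q1' @ False # Q2'"
    have Q: "Q1 = Q1' \<and> Q2 = Q2'"
      using dyck_node_inject[of Q1 Q2 Q1' Q2'] eqQ intervalsD(2)[OF I(1)] intervalsD(2)[OF I'(1)] by simp
    have P: "l = l' \<and> r @ P2 = r' @ P2'"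
      using dyck_node_inject[of l "r @ P2" l' "r' @ P2'"] eqP I(3) I'(3) by (simp add: splits_def)
    have m: "m = m'"
      using Q intervalsD(4)[OF I(1)] intervalsD(4)[OF I'(1)] by simp
    have "length P2 = length P2'"
      using m intervalsD(3)[OF I(2)] intervalsD(3)[OF I'(2)] by simp
    with P have "r = r' \<and> P2 = P2'"
      by simp
    then show "m = m' \<and> P1 = P1' \<and> Q1 = Q1' \<and> P2 = P2' \<and> Q2 = Q2' \<and> l = l' \<and> r = r'"
      using P Q m I(3) I'(3) by (auto simp: splits_def)
  qed
next
  fix p assume "p \<in> ?f ` ?Z"
  then obtain m P1 Q1 P2 Q2 l r where m: "m \<le> n"
    and I: "(P1, Q1) \<in> intervals m" "(P2, Q2) \<in> intervals (n - m)" "(l, r) \<in> splits P1"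
    and p: "p = (True # l @ False # r @ P2, True # Q1 @ False # Q2)"
    by auto
  note d = intervalsD[OF I(1)] intervalsD[OF I(2)]
  have lr: "dyck_word l" "dyck_word r" "P1 = l @ r"
    using I(3) by (auto simp: splits_def)
  show "p \<in> intervals (Suc n)"
    unfolding p
    using d lr m by (intro intervalsI dyck_word_node dyck_word_append tamari_le_node) simp_all
next
  fix p assume "p \<in> intervals (Suc n)"
  then obtain P Q where p: "p = (P, Q)" "(P, Q) \<in> intervals (Suc n)"
    by (cases p) auto
  note d = intervalsD[OF p(2)]
  from d(2) show "p \<in> ?f ` ?Z"
  proof (cases rule: dyck_word_cases)
    case Nil
    then show ?thesis using d by simp
  next
    case (node Q1 Q2)
    then obtain l r P2 where P: "P = True # l @ False # r @ P2"
      and *: "dyck_word l" "dyck_word r" "dyck_word P2" "tamari_le (l @ r) Q1" "tamari_le P2 Q2"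
      using tamari_le_node_decomp[of P Q1 Q2] d(5) by blast
    obtain m where m: "length Q1 = 2 * m"
      using even_length_dyck_word[OF node(2)] by blast
    have len: "length Q2 = 2 * (n - m)" "m \<le> n"
      using d(4) m node(1) by auto
    have "(l @ r, Q1) \<in> intervals m" "(P2, Q2) \<in> intervals (n - m)"
      using * node m len by (auto intro!: intervalsI dyck_word_append)
    then have "(m, (l @ r, Q1), (P2, Q2), (l, r)) \<in> ?Z"
      using * len by (auto simp: splits_def)
    moreover have "p = ?f (m, (l @ r, Q1), (P2, Q2), (l, r))"
      using p P node by simp
    ultimately show ?thesis by blast
  qed
qed

lemma sum_intervals_Suc:
  fixes f :: "bool list \<Rightarrow> bool list \<Rightarrow> 'a::comm_monoid_add"
  shows "(\<Sum>(P, Q)\<in>intervals (Suc n). f P Q) =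
    (\<Sum>m\<le>n. \<Sum>(P1, Q1)\<in>intervals m. \<Sum>(P2, Q2)\<in>intervals (n - m). \<Sum>(l, r)\<in>splits P1.
       f (True # l @ False # r @ P2) (True # Q1 @ False # Q2))"
  by (subst sum.reindex_bij_betw[OF bij_betw_intervals_Suc, symmetric])
     (simp add: sum.Sigma split_def)

section \<open>Functional equations\<close>

text \<open>The ring of \<open>x\<close> is arbitrary, so that \<open>x\<close> can later be a power
  series itself.\<close>

definition interval_fps :: "'a::comm_ring_1 \<Rightarrow> 'a fps" where
  "interval_fps x = Abs_fps (\<lambda>n. \<Sum>(P, Q)\<in>intervals n. x ^ returns 0 P)"

definition marked_interval_fps :: "'a::comm_ring_1 \<Rightarrow> 'a \<Rightarrow> 'a fps" where
  "marked_interval_fps s x =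
     Abs_fps (\<lambda>n. \<Sum>(P, Q)\<in>intervals n. x ^ returns 0 P * hsum (\<lambda>h. s ^ nat h) Q)"

lemma sum_splits_node:
  fixes x :: "'a::comm_ring_1"
  assumes "(P1, Q1) \<in> intervals m"
  shows "(x - 1) * (\<Sum>(l, r)\<in>splits P1. x ^ returns 0 (True # l @ False # r @ P2)) =
    x * (x * x ^ returns 0 P1 - 1) * x ^ returns 0 P2"
proof -
  have "(\<Sum>(l, r)\<in>splits P1. x ^ returns 0 (True # l @ False # r @ P2)) =
        (\<Sum>(l, r)\<in>splits P1. x ^ returns 0 r) * (x * x ^ returns 0 P2)"
    unfolding sum_distrib_right
    by (intro sum.cong refl)
       (auto simp: splits_def returns_node returns_dyck_append power_add mult_ac)
  then have "(x - 1) * (\<Sum>(l, r)\<in>splits P1. x ^ returns 0 (True # l @ False # r @ P2)) =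
      ((x - 1) * (\<Sum>(l, r)\<in>splits P1. x ^ returns 0 r)) * (x * x ^ returns 0 P2)"
    by (simp only: mult.assoc)
  then show ?thesis
    unfolding sum_splits_power[OF intervalsD(1)[OF assms]] by (simp only: mult_ac)
qed

text \<open>The weight \<open>w\<close> sees only the upper path, so the sum over cuts of
  \<open>P1\<close> is still geometric.\<close>

lemma sum_intervals_node:
  fixes x :: "'a::comm_ring_1"
  shows "(x - 1) * (\<Sum>(P, Q)\<in>intervals (Suc n). x ^ returns 0 P * w Q) =
    (\<Sum>m\<le>n. \<Sum>(P1, Q1)\<in>intervals m. \<Sum>(P2, Q2)\<in>intervals (n - m).
       x * (x * x ^ returns 0 P1 - 1) * x ^ returns 0 P2 * w (True # Q1 @ False # Q2))"
proof -
  have "(x - 1) * (\<Sum>(l, r)\<in>splits (fst I). x ^ returns 0 (True # l @ False # r @ P2) * c) =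
      x * (x * x ^ returns 0 (fst I) - 1) * x ^ returns 0 P2 * c"
    if "I \<in> intervals m" for I m P2 c
    using sum_splits_node[of "fst I" "snd I" m x P2] that
    by (simp add: split_def sum_distrib_right[symmetric] mult.assoc[symmetric])
  then show ?thesis
    unfolding sum_intervals_Suc
    unfolding sum_distrib_left split_def
    by (intro sum.cong refl) (simp add: split_def sum_distrib_left)
qed

lemma interval_fps_nth: "fps_nth (interval_fps x) n = (\<Sum>(P, Q)\<in>intervals n. x ^ returns 0 P)"
  by (simp add: interval_fps_def)

lemma marked_interval_fps_nth:
  "fps_nth (marked_interval_fps s x) n =
    (\<Sum>(P, Q)\<in>intervals n. x ^ returns 0 P * hsum (\<lambda>h. s ^ nat h) Q)"
  by (simp add: marked_interval_fps_def)

text \<open>The lower end of the geometric sum forgets the returns of \<open>P1\<close>; this is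
  where \<open>interval_fps 1\<close> enters.\<close>

lemma interval_fps_equation:
  fixes x :: "'a::comm_ring_1"
  defines "F \<equiv> interval_fps x"
  shows "fps_const (x - 1) * (F - 1) =
    fps_X * (fps_const x * ((fps_const x * F - interval_fps 1) * F))"
proof (rule fps_ext)
  fix n
  show "fps_nth (fps_const (x - 1) * (F - 1)) n =
    fps_nth (fps_X * (fps_const x * ((fps_const x * F - interval_fps 1) * F))) n"
  proof (cases n)
    case 0
    then show ?thesis
      by (simp add: F_def interval_fps_def intervals_0)
  next
    case (Suc k)
    have "(x - 1) * fps_nth F (Suc k) =
      (\<Sum>m\<le>k. \<Sum>(P1, Q1)\<in>intervals m. \<Sum>(P2, Q2)\<in>intervals (k - m).
         x * (x * x ^ returns 0 P1 - 1) * x ^ returns 0 P2)"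
      using sum_intervals_node[where x = x and n = k and w = "\<lambda>_. 1"] by (simp add: F_def interval_fps_nth)
    also have "\<dots> = (\<Sum>m\<le>k. x * ((x * fps_nth F m - fps_nth (interval_fps 1) m) * fps_nth F (k - m)))"
      unfolding F_def interval_fps_nth split_def
      unfolding sum_distrib_left[of x "\<lambda>I. x ^ returns 0 (fst I)"] sum_subtractf[symmetric]
      unfolding sum_product
      unfolding sum_distrib_left
      by (intro sum.cong refl) (simp add: mult.assoc)
    finally show ?thesis
      using Suc by (simp add: fps_mult_nth[of "fps_const x * F - interval_fps 1"] atLeast0AtMost sum_distrib_left)
  qed
qed

text \<open>The three summands correspond to a marked abscissa at the origin, in the raised copy of
  \<open>Q1\<close>, and in \<open>Q2\<close>.\<close>

lemma marked_interval_fps_equation: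
  fixes x s :: "'a::comm_ring_1"
  defines "F \<equiv> interval_fps x" and "H \<equiv> marked_interval_fps s x"
  shows "fps_const (x - 1) * (H - 1) =
    fps_X * (fps_const x * ((fps_const x * F - interval_fps 1) * F +
      fps_const s * ((fps_const x * H - marked_interval_fps s 1) * F) +
      (fps_const x * F - interval_fps 1) * H))"
proof (rule fps_ext)
  fix n
  show "fps_nth (fps_const (x - 1) * (H - 1)) n =
    fps_nth (fps_X * (fps_const x * ((fps_const x * F - interval_fps 1) * F +
      fps_const s * ((fps_const x * H - marked_interval_fps s 1) * F) +
      (fps_const x * F - interval_fps 1) * H))) n"
  proof (cases n)
    case 0
    then show ?thesis
      by (simp add: H_def marked_interval_fps_nth intervals_0)
  next
    case (Suc k)
    let ?h = "hsum (\<lambda>h. s ^ nat h)"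
    have "(x - 1) * fps_nth H (Suc k) =
      (\<Sum>m\<le>k. \<Sum>(P1, Q1)\<in>intervals m. \<Sum>(P2, Q2)\<in>intervals (k - m).
         x * (x * x ^ returns 0 P1 - 1) * x ^ returns 0 P2 * ?h (True # Q1 @ False # Q2))"
      using sum_intervals_node[where x = x and n = k and w = ?h] by (simp add: H_def marked_interval_fps_nth)
    also have "\<dots> = (\<Sum>m\<le>k. \<Sum>(P1, Q1)\<in>intervals m. \<Sum>(P2, Q2)\<in>intervals (k - m).
         x * ((x * x ^ returns 0 P1 - 1) * x ^ returns 0 P2 +
           s * ((x * (x ^ returns 0 P1 * ?h Q1) - ?h Q1) * x ^ returns 0 P2) +
           (x * x ^ returns 0 P1 - 1) * (x ^ returns 0 P2 * ?h Q2)))"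
      by (intro sum.cong refl)
         (auto simp: hsum_power_node[OF intervalsD(2)] algebra_simps intro!: sum.cong)
    also have "\<dots> = (\<Sum>m\<le>k. x * ((x * fps_nth F m - fps_nth (interval_fps 1) m) * fps_nth F (k - m) +
           s * ((x * fps_nth H m - fps_nth (marked_interval_fps s 1) m) * fps_nth F (k - m)) +
           (x * fps_nth F m - fps_nth (interval_fps 1) m) * fps_nth H (k - m)))"
      unfolding F_def H_def interval_fps_nth marked_interval_fps_nth split_def
      unfolding sum_distrib_left[of x "\<lambda>I. x ^ returns 0 (fst I)"]
        sum_distrib_left[of x "\<lambda>I. x ^ returns 0 (fst I) * ?h (snd I)"] sum_subtractf[symmetric]
      unfolding sum_product
      unfolding sum_distrib_left sum.distrib[symmetric]
      by (intro sum.cong refl) (simp add: mult.assoc)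
    finally show ?thesis
      using Suc by (simp add: fps_mult_nth[of "fps_const x * F - interval_fps 1"]
        fps_mult_nth[of "fps_const x * H - marked_interval_fps s 1"] atLeast0AtMost sum_distrib_left
        sum.distrib distrib_left)
  qed
qed

section \<open>Solution of the equations\<close>

text \<open>Substitutes the coefficient variable for the outer variable: it turns a series in \<open>T\<close> over
  series in \<open>t\<close> into \<open>A(T = t)\<close>, so that the catalytic variable may itself be a series in \<open>t\<close>.\<close>
definition diag :: "'a::comm_ring_1 fps fps \<Rightarrow> 'a fps" where
  "diag A = Abs_fps (\<lambda>n. \<Sum>k\<le>n. fps_nth (fps_nth A k) (n - k))"

lemma diag_add: "diag (A + B) = diag A + diag B"
  by (rule fps_ext) (simp add: diag_def sum.distrib)

lemma diag_diff: "diag (A - B) = diag A - diag B"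
  by (rule fps_ext) (simp add: diag_def sum_subtractf)

lemma diag_const: "diag (fps_const c) = c"
proof (rule fps_ext)
  fix n
  have "(\<Sum>k\<le>n. fps_nth (if k = 0 then c else 0) (n - k)) = (\<Sum>k\<le>n. if k = 0 then fps_nth c n else 0)"
    by (intro sum.cong) auto
  then show "fps_nth (diag (fps_const c)) n = fps_nth c n"
    by (simp add: diag_def)
qed

lemma diag_1: "diag 1 = 1"
  using diag_const[of 1] by simp

lemma diag_const_mult: "diag (fps_const c * A) = c * diag A"
proof (rule fps_ext)
  fix n
  \<comment> \<open>Both sides sum over the triangle \<open>i + k \<le> n\<close>.\<close>
  have "(\<Sum>k\<le>n. \<Sum>i\<le>n - k. fps_nth c i * fps_nth (fps_nth A k) (n - k - i)) =
        (\<Sum>i\<le>n. \<Sum>k\<le>n - i. fps_nth c i * fps_nth (fps_nth A k) (n - k - i))"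
    by (simp add: sum.Sigma)
       (rule sum.reindex_bij_witness[of _ "\<lambda>(i, k). (k, i)" "\<lambda>(i, k). (k, i)"]; force)
  then show "fps_nth (diag (fps_const c * A)) n = fps_nth (c * diag A) n"
    by (simp add: diag_def fps_mult_nth[of c] atLeast0AtMost sum_distrib_left)
       (simp add: add.commute)
qed

lemma diag_X_mult: "diag (fps_X * A) = fps_X * diag A"
proof (rule fps_ext)
  fix n
  show "fps_nth (diag (fps_X * A)) n = fps_nth (fps_X * diag A) n"
    by (cases n) (simp_all add: diag_def sum.atMost_Suc_shift del: sum.atMost_Suc)
qed

lemma diag_X: "diag fps_X = fps_X"
  using diag_X_mult[of 1] by (simp add: diag_1)

text \<open>Splitting off the constant term of \<open>B\<close> leaves a factor
  \<open>fps_X\<close>, which lowers the coefficient index by one.\<close>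

lemma diag_mult: "diag (A * B) = diag A * diag B"
proof (rule fps_ext)
  fix n
  show "fps_nth (diag (A * B)) n = fps_nth (diag A * diag B) n"
  proof (induction n arbitrary: B rule: less_induct)
    case (less n)
    define B' where "B' = fps_shift 1 B"
    have B: "B = fps_const (fps_nth B 0) + fps_X * B'"
      by (rule fps_ext) (auto simp: B'_def)
    have "A * B = fps_const (fps_nth B 0) * A + fps_X * (A * B')"
      by (subst B) (simp add: algebra_simps)
    then have 1: "diag (A * B) = fps_nth B 0 * diag A + fps_X * diag (A * B')"
      by (simp add: diag_add diag_const_mult diag_X_mult)
    have "diag B = fps_nth B 0 + fps_X * diag B'"
      by (subst B) (simp add: diag_add diag_const diag_X_mult)
    then have 2: "diag A * diag B = fps_nth B 0 * diag A + fps_X * (diag A * diag B')"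
      by (simp add: algebra_simps)
    show ?case
      unfolding 1 2 using less.IH[of "n - 1" B'] by simp
  qed
qed

lemma diag_coeff_const:
  assumes "\<And>n. fps_nth A n = fps_const (c n)"
  shows "diag A = Abs_fps c"
proof (rule fps_ext)
  fix n
  have "(\<Sum>k\<le>n. fps_nth (fps_const (c k)) (n - k)) = (\<Sum>k\<le>n. if k = n then c n else 0)"
    by (intro sum.cong) auto
  then show "fps_nth (diag A) n = fps_nth (Abs_fps c) n"
    using assms by (simp add: diag_def)
qed

text \<open>Specialisation \<open>s = 1\<close>, kept in the same ring so that \<open>spec1 f = f\<close> says that \<open>f\<close> is free of \<open>s\<close>.\<close>
definition spec1 :: "'a::comm_ring_1 poly fps \<Rightarrow> 'a poly fps" where
  "spec1 f = Abs_fps (\<lambda>n. [:poly (fps_nth f n) 1:])"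

lemma spec1_nth: "fps_nth (spec1 f) n = [:poly (fps_nth f n) 1:]"
  by (simp add: spec1_def)

lemma const_poly_sum: "[:\<Sum>i\<in>A. f i:] = (\<Sum>i\<in>A. [:f i:])"
  by (rule poly_eqI) (simp add: coeff_sum coeff_pCons split: nat.split)

lemma spec1_mult: "spec1 (f * g) = spec1 f * spec1 g"
  by (rule fps_ext) (simp add: spec1_nth fps_mult_nth poly_sum const_poly_sum mult.commute)

lemma spec1_diff: "spec1 (f - g) = spec1 f - spec1 g"
  by (rule fps_ext) (simp add: spec1_nth)

lemma spec1_1: "spec1 1 = 1"
  by (rule fps_ext) (simp add: spec1_nth one_pCons)

lemma spec1_X: "spec1 fps_X = fps_X"
  by (rule fps_ext) (simp add: spec1_nth fps_X_def one_pCons)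

lemma spec1_power: "spec1 (f ^ n) = spec1 f ^ n"
  by (induction n) (simp_all add: spec1_1 spec1_mult)

text \<open>The difference of the two sides is \<open>a - b\<close> times a series with constant
  term 1. This yields uniqueness of \<open>z\<close>, used to see that \<open>z\<close> is free of
  \<open>s\<close>.\<close>

lemma mult_one_minus_cube_inject:
  fixes a b :: "'a::idom fps"
  assumes "a * (1 - a) ^ 3 = b * (1 - b) ^ 3" "fps_nth a 0 = 0" "fps_nth b 0 = 0"
  shows "a = b"
proof -
  let ?k = "1 - 3 * (a + b) + 3 * (a\<^sup>2 + a * b + b\<^sup>2) - (a ^ 3 + a\<^sup>2 * b + a * b\<^sup>2 + b ^ 3)"
  have "(a - b) * ?k = a * (1 - a) ^ 3 - b * (1 - b) ^ 3"
    by (simp add: algebra_simps power2_eq_square power3_eq_cube)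
  moreover have "fps_nth ?k 0 = 1"
    using assms by (simp add: power2_eq_square power3_eq_cube)
  then have "?k \<noteq> 0"
    by (metis fps_zero_nth zero_neq_one)
  ultimately show ?thesis
    using assms(1) by simp
qed

text \<open>Coefficients will lie in \<open>rat poly\<close>, which is no field; constant term 1
  still guarantees a reciprocal.\<close>

lemma unit_fps_ex:
  fixes f :: "'a::comm_ring_1 fps"
  assumes "fps_nth f 0 = 1"
  obtains g where "f * g = 1" "fps_nth g 0 = 1"
proof -
  have "f * fps_right_inverse f 1 = 1"
    using assms by (intro fps_right_inverse) simp
  then show ?thesis
    using that by simp
qed

text \<open>Two solutions satisfy \<open>(E - G) K = - x G (E1 - G1)\<close> with \<open>K(t = 0) = s - 1\<close>. At \<open>s = 1\<close> the
  leading coefficient of the left-hand side vanishes, whereas that of \<open>E1 - G1\<close> is free of \<open>s\<close>.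
  Hence one equation determines both unknowns.\<close>
lemma kernel_unique:
  fixes E E1 G G1 V x :: "rat poly fps"
  assumes E: "V * (E - 1) = x * ((x * E - E1) * E)"
    and G: "V * (G - 1) = x * ((x * G - G1) * G)"
    and nth0: "fps_nth E 0 = 1" "fps_nth G 0 = 1" "fps_nth E1 0 = 1" "fps_nth x 0 = 1"
      "fps_nth V 0 = [:0, 1:]"
    and spec1: "spec1 E1 = E1" "spec1 G1 = G1"
  shows "E = G \<and> E1 = G1"
proof -
  define d where "d = E1 - G1"
  let ?K = "V - x * (x * (E + G) - E1)"
  have eq: "(E - G) * ?K = - (x * G * d)"
  proof -
    have "(E - G) * ?K = V * (E - 1) - V * (G - 1) - x * (x * (E + G) - E1) * (E - G)"
      by (simp add: algebra_simps)
    also have "\<dots> = - (x * G * d)"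
      unfolding E G d_def by (simp add: algebra_simps)
    finally show ?thesis .
  qed
  \<comment> \<open>The constant terms give \<open>s - 1 * (1 * (1 + 1) - 1)\<close>.\<close>
  have K0: "fps_nth ?K 0 = [:-1, 1:]"
    using nth0 by (simp add: one_pCons)
  have "d = 0"
  proof (rule ccontr)
    assume "d \<noteq> 0"
    define n where "n = subdegree d"
    have xG: "fps_nth (x * G) 0 = 1"
      using nth0 by simp
    \<comment> \<open>Nonzero constant terms of these factors force \<open>E - G\<close> and
      \<open>d\<close> to have the same order \<open>n\<close>.\<close>
    have sub0: "subdegree ?K = 0" "subdegree (x * G) = 0"
      using K0 xG by (simp_all add: subdegree_eq_0_iff)
    have nz: "?K \<noteq> 0" "x * G \<noteq> 0"
      using K0 xG by (metis fps_zero_nth pCons_eq_0_iff zero_neq_one, metis fps_zero_nth zero_neq_one)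
    have "E - G \<noteq> 0"
      using eq nz \<open>d \<noteq> 0\<close> by auto
    then have "subdegree (E - G) = n"
      using arg_cong[OF eq, of subdegree] nz \<open>d \<noteq> 0\<close> sub0 by (simp add: n_def)
    then have "fps_nth ((E - G) * ?K) n = fps_nth (E - G) n * [:-1, 1:]"
      using nth_subdegree_mult[of "E - G" ?K] sub0 K0 by simp
    moreover have "fps_nth (x * G * d) n = fps_nth d n"
      using nth_subdegree_mult[of "x * G" d] sub0 xG by (simp add: n_def)
    ultimately have "fps_nth (E - G) n * [:-1, 1:] = - fps_nth d n"
      using eq by simp
    then have "poly (fps_nth (E - G) n * [:-1, 1:]) 1 = poly (- fps_nth d n) 1"
      by (rule arg_cong)
    then have "poly (fps_nth d n) 1 = 0"
      by (simp only: poly_mult poly_minus) simp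
    moreover have "spec1 d = d"
      by (simp add: d_def spec1_diff spec1)
    then have "fps_nth d n = [:poly (fps_nth d n) 1:]"
      by (metis spec1_nth)
    ultimately show False
      using \<open>d \<noteq> 0\<close> by (simp add: n_def)
  qed
  moreover have "?K \<noteq> 0"
    using K0 by (metis fps_zero_nth pCons_eq_0_iff zero_neq_one)
  ultimately show ?thesis
    using eq by (simp add: d_def)
qed

text \<open>At \<open>x = 1\<close> the coefficients are numbers of intervals, hence constant
  polynomials.\<close>

lemma spec1_diag_interval_fps: "spec1 (diag (interval_fps 1)) = (diag (interval_fps 1) :: rat poly fps)"
proof -
  have "diag (interval_fps 1) = Abs_fps (\<lambda>n. of_nat (card (intervals n)) :: rat poly)"
    by (intro diag_coeff_const) (simp add: interval_fps_nth split_def fps_of_nat)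
  then show ?thesis
    by (simp add: fps_eq_iff spec1_nth of_nat_poly)
qed

lemma fps_const_sum: "fps_const (\<Sum>i\<in>A. f i) = (\<Sum>i\<in>A. fps_const (f i))"
  by (induction A rule: infinite_finite_induct) (auto simp flip: fps_const_add)

lemma H1_eq: "diag (marked_interval_fps (fps_const [:0, 1:]) 1) = H1"
proof -
  have hs: "hsum (\<lambda>h. fps_const [:0, 1 :: rat:] ^ nat h) Q = fps_const (\<Sum>i = 0..2 * n. monom 1 (height_at Q i))"
    if "(P, Q) \<in> intervals n" for P Q n
  proof -
    have "[:0, 1 :: rat:] ^ k = monom 1 k" for k
      by (simp add: monom_altdef)
    then show ?thesis
      using intervalsD(4)[OF that]
      by (simp add: hsum_def height_at_def atLeast0AtMost fps_const_sum)
  qed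
  have "fps_nth (marked_interval_fps (fps_const [:0, 1 :: rat:]) 1) n =
      fps_const (\<Sum>(P, Q)\<in>intervals n. \<Sum>i = 0..2 * n. monom 1 (height_at Q i))" for n
    unfolding marked_interval_fps_nth fps_const_sum
    by (intro sum.cong refl) (auto simp only: power_one mult_1_left hs)
  then show ?thesis
    unfolding H1_def by (rule diag_coeff_const)
qed

section \<open>Solution by the kernel method\<close>

theorem theorem2p3:
  fixes z U :: "rat poly fps"
  assumes z0: "fps_nth z 0 = 0"
    and zdef: "fps_X = z * (1 - z) ^ 3"
    and U0: "fps_nth U 0 = 0"
    and Ueq: "fps_const [:0, 1:] * (1 + U)\<^sup>2 * fps_X * (U * fps_X\<^sup>2 + 2 * fps_X - 1)
              + U * (1 - fps_X) ^ 3 = 0"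
  shows "H1 * (1 - z) ^ 6 = (1 - 2 * z - (U oo z) * z\<^sup>2)\<^sup>2 * (1 + (U oo z))"
proof -
  define s :: "rat poly fps" where "s = fps_const [:0, 1:]"
  define t :: "rat poly fps" where "t = fps_X"
  \<comment> \<open>\<open>U\<close> is a series in the variable z; \<open>u\<close> is the same
    quantity as a series in \<open>t\<close>.\<close>
  define u where "u = U oo z"
  define p where "p = 1 - 2 * z - u * z\<^sup>2"
  have u0: "fps_nth u 0 = 0"
    using U0 by (simp add: u_def fps_compose_nth)
  have "(fps_const [:0, 1:] * (1 + U)\<^sup>2 * fps_X * (U * fps_X\<^sup>2 + 2 * fps_X - 1)
              + U * (1 - fps_X) ^ 3) oo z = 0"
    unfolding Ueq by simp
  then have "s * (1 + u)\<^sup>2 * z * (u * z\<^sup>2 + 2 * z - 1) + u * (1 - z) ^ 3 = 0"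
    using z0 by (simp add: fps_compose_add_distrib fps_compose_sub_distrib fps_compose_mult_distrib
        fps_compose_power[symmetric] fps_const_mult_apply_left u_def s_def power2_eq_square power3_eq_cube)
  then have ueq0: "u * (1 - z) ^ 3 = s * (1 + u)\<^sup>2 * z * p"
    unfolding p_def by (simp add: algebra_simps)
  \<comment> \<open>\<open>w\<close> and \<open>q\<close> are the reciprocals needed to write the
    rational expressions without division.\<close>
  obtain w where w: "(1 + z * u) * w = 1" "fps_nth w 0 = 1"
    using unit_fps_ex[of "1 + z * u"] z0 by auto
  obtain q where q: "(1 - z) ^ 3 * q = 1" "fps_nth q 0 = 1"
    using unit_fps_ex[of "(1 - z) ^ 3"] z0 by (auto simp: power3_eq_cube)
  have z: "z = t * q"
    using zdef q(1) by (metis mult.assoc mult.right_neutral t_def)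
  have ueq: "u = s * (1 + u)\<^sup>2 * z * p * q"
    using ueq0 q(1) by (metis mult.assoc mult.right_neutral)
  \<comment> \<open>\<open>V\<close> is \<open>(x - 1) / t\<close>; \<open>G\<close> and
    \<open>G1\<close> are the values claimed for \<open>E(x)\<close> and
    \<open>E(1)\<close>.\<close>
  define x where "x = (1 + u) * w\<^sup>2"
  define V where "V = s * (1 + u)\<^sup>2 * p\<^sup>2 * q\<^sup>2 * w\<^sup>2"
  define G where "G = (1 + z * u) * p * q"
  define G1 where "G1 = (1 - 2 * z) * q"
  define E where "E = diag (interval_fps x)"
  define E1 where "E1 = diag (interval_fps (1 :: rat poly fps))"
  define H where "H = diag (marked_interval_fps s x)"
  txt \<open>The kernel of the equation for \<open>H\<close> vanishes exactly when \<open>x - 1 = t * s * (x * E)\<^sup>2\<close>.\<close>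
  have xV: "x - 1 = t * V"
  proof -
    have "x - 1 = w\<^sup>2 * u * p"
      using w(1) unfolding x_def p_def by algebra
    also have "\<dots> = t * V"
      using ueq z unfolding V_def by algebra
    finally show ?thesis .
  qed
  have Geq: "V * (G - 1) = x * ((x * G - G1) * G)"
  proof -
    \<comment> \<open>\<open>?R\<close> is a common factor of \<open>G - 1\<close> and
      \<open>x * G - G1\<close>. What remains agrees after one factor \<open>u\<close> is replaced
      by means of \<open>ueq\<close>.\<close>
    let ?R = "1 - 3 * z + z\<^sup>2 - u * z\<^sup>2"
    have "G - 1 = q * z * (1 + u) * ?R"
      using q(1) unfolding G_def p_def by algebra
    moreover have xG: "x * G = (1 + u) * w * p * q"
      using w(1) unfolding G_def x_def by algebra
    moreover have "x * G - G1 = w * q * u * ?R"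
      using w(1) unfolding xG G1_def p_def by algebra
    ultimately have "V * (G - 1) = s * (1 + u)\<^sup>2 * p\<^sup>2 * q\<^sup>2 * w\<^sup>2 * (q * z * (1 + u) * ?R)"
      and "x * ((x * G - G1) * G) = (1 + u) * w * p * q * (w * q * (s * (1 + u)\<^sup>2 * z * p * q) * ?R)"
      using ueq by (simp_all add: V_def mult_ac)
    then show ?thesis
      by (simp add: power2_eq_square mult_ac)
  qed
  \<comment> \<open>\<open>diag\<close> turns the equation over series in \<open>t\<close> into one
    between series in \<open>t\<close>. Since \<open>t\<close> divides \<open>x - 1\<close>, it can
    then be cancelled.\<close>
  have "(x - 1) * (E - 1) = t * (x * ((x * E - E1) * E))"
    using arg_cong[OF interval_fps_equation[of x], of diag]
    by (simp add: diag_mult diag_diff diag_const diag_1 diag_X E_def E1_def t_def)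
  then have "t * (V * (E - 1)) = t * (x * ((x * E - E1) * E))"
    by (simp add: xV mult.assoc)
  then have Eeq: "V * (E - 1) = x * ((x * E - E1) * E)"
    by (simp add: t_def)
  have p0: "fps_nth p 0 = 1"
    using z0 by (simp add: p_def power2_eq_square)
  \<comment> \<open>Setting \<open>s = 1\<close> fixes \<open>t\<close>, so \<open>spec1 z\<close>
    solves the equation that defines \<open>z\<close>; the reciprocal \<open>q\<close> inherits the
    invariance.\<close>
  have "spec1 z * (1 - spec1 z) ^ 3 = fps_X"
    using arg_cong[OF zdef, of spec1]
    by (simp add: spec1_mult spec1_power spec1_diff spec1_1 spec1_X)
  then have "spec1 z * (1 - spec1 z) ^ 3 = z * (1 - z) ^ 3"
    by (rule trans) (rule zdef)
  then have spec1_z: "spec1 z = z"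
    by (rule mult_one_minus_cube_inject) (use z0 in \<open>simp_all add: spec1_nth\<close>)
  have "(1 - z) ^ 3 * spec1 q = 1"
    using arg_cong[OF q(1), of spec1] by (simp add: spec1_mult spec1_power spec1_diff spec1_1 spec1_z)
  then have "((1 - z) ^ 3 * q) * spec1 q = q"
    by (simp add: mult_ac)
  then have spec1_q: "spec1 q = q"
    using q(1) by simp
  have spec1_G1: "spec1 G1 = G1"
  proof -
    have "G1 = (1 - z - z) * q"
      by (simp add: G1_def)
    then show ?thesis
      by (simp only: spec1_mult spec1_diff spec1_1 spec1_z spec1_q)
  qed
  have nth0: "fps_nth E 0 = 1" "fps_nth E1 0 = 1" "fps_nth G 0 = 1" "fps_nth x 0 = 1"
      "fps_nth V 0 = [:0, 1:]" "fps_nth s 0 = [:0, 1:]"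
    using z0 u0 w(2) q(2) p0
    by (simp_all add: E_def E1_def diag_def interval_fps_nth intervals_0 G_def x_def V_def s_def
        power2_eq_square)
  have "spec1 E1 = E1"
    unfolding E1_def by (rule spec1_diag_interval_fps)
  with nth0 spec1_G1 have "E = G \<and> E1 = G1"
    by (intro kernel_unique[OF Eeq Geq])
  then have EG: "E = G" by simp
  have Heq: "(x - 1) * (H - 1) = t * (x * ((x * E - E1) * E + s * ((x * H - H1) * E) + (x * E - E1) * H))"
    using arg_cong[OF marked_interval_fps_equation[of x s], of diag]
    by (simp add: diag_mult diag_diff diag_add diag_const diag_1 diag_X E_def E1_def H_def t_def
        H1_eq s_def)
  have VG: "V = s * x\<^sup>2 * G\<^sup>2"
    using w(1) unfolding V_def x_def G_def by algebra
  have "t * V * (H - 1) = t * (x * ((x * E - E1) * E + s * ((x * H - H1) * E) + (x * E - E1) * H))"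
    using Heq xV by simp
  then have V1: "V * (H - 1) = x * ((x * E - E1) * E + s * ((x * H - H1) * E) + (x * E - E1) * H)"
    by (simp add: t_def mult.assoc)
  \<comment> \<open>Multiply \<open>V1\<close> by \<open>E\<close> and replace
    \<open>x * (x * E - E1) * E\<close> by \<open>V * (E - 1)\<close>. With \<open>VG\<close> every
    term in \<open>H\<close> cancels.\<close>
  have "E\<^sup>2 * x * s * (H1 - x * G\<^sup>2) = 0"
    using V1 Eeq VG unfolding EG by algebra
  moreover have "E \<noteq> 0" "x \<noteq> 0" "s \<noteq> 0"
    using nth0 by auto
  ultimately have "H1 = x * G\<^sup>2"
    by simp
  also have "\<dots> = (1 + u) * p\<^sup>2 * q\<^sup>2"
    using w(1) unfolding x_def G_def by algebra
  finally have "H1 * (1 - z) ^ 6 = (1 + u) * p\<^sup>2 * ((1 - z) ^ 3 * q)\<^sup>2"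
    by (simp add: power_mult_distrib mult_ac flip: power_mult)
  then show ?thesis
    using q(1) by (simp add: p_def u_def mult.commute)
qed

end
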